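(* Let $G$ be a perfect graph with two enemy cliques $K_1$ and $K_2$. Then $G_{K_1\equiv K_2}$ is also perfect.
   Context: Graphs are finite, simple, undirected. A graph $G$ is perfect if $\chi(G')=\omega(G')$ for every induced subgraph $G'$ of $G$. A clique of $G$ is an induced subgraph of $G$ that is a complete graph. A path of $G$ is an induced subgraph that is a chordless path (possibly a single vertex); its length is its number of edges. For two cliques $K_1,K_2$ of $G$, an outgoing path linking $K_1$ and $K_2$ is a path of $G$ with one end in $K_1$, the other end in $K_2$, and all interior vertices in $V(G)\setminus(V(K_1)\cup V(K_2))$. The cliques $K_1$ and $K_2$ are enemies if every outgoing path linking $K_1$ and $K_2$ has odd length. (In particular enemy cliques are disjoint, since a common vertex would be an outgoing path of length 0.) For enemy cliques $K_1,K_2$ of $G$, the graph $G_{K_1\equiv K_2}$ is obtained from $G$ by making every vertex of $K_1$ adjacent to every vertex of $K_2$. *)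

theory Defs
  imports "Graph_Theory.Graph_Theory"
begin

text \<open>
  Finite simple undirected graphs are the AFP's \<^locale>\<open>pair_graph\<close>s: a finite vertex set
  \<^const>\<open>pverts\<close> with a symmetric irreflexive relation \<^const>\<open>parcs\<close> (each edge occurs
  in both orientations). The null graph is a graph. Induced subgraphs, complete graphs and
  vertex paths are those of the AFP entry, used through the coercion \<^const>\<open>with_proj\<close>.
\<close>

definition colouring :: "'a pair_pre_digraph \<Rightarrow> nat \<Rightarrow> ('a \<Rightarrow> nat) \<Rightarrow> bool" where
  "colouring G k c \<longleftrightarrow>
     (\<forall>v \<in> pverts G. c v < k) \<and> (\<forall>(u, v) \<in> parcs G. c u \<noteq> c v)"

definition chromatic_number :: "'a pair_pre_digraph \<Rightarrow> nat" where
  "chromatic_number G = (LEAST k. \<exists>c. colouring G k c)"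

definition clique :: "'a pair_pre_digraph \<Rightarrow> 'a pair_pre_digraph \<Rightarrow> bool" where
  "clique K G \<longleftrightarrow>
     induced_subgraph (with_proj K) (with_proj G) \<and>
     complete_digraph (card (pverts K)) (with_proj K)"

definition clique_number :: "'a pair_pre_digraph \<Rightarrow> nat" where
  "clique_number G = Max {card (pverts K) | K. clique K G}"

definition perfect_graph :: "'a pair_pre_digraph \<Rightarrow> bool" where
  "perfect_graph G \<longleftrightarrow>
     pair_graph G \<and>
     (\<forall>H :: 'a pair_pre_digraph. induced_subgraph (with_proj H) (with_proj G) \<longrightarrow>
        chromatic_number H = clique_number H)"

text \<open>
  A path of \<open>G\<close> is given by listing its vertices from one end to the other: the vertices
  are distinct, consecutive ones are adjacent (\<^const>\<open>vpath\<close>) and no others are.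
  It is therefore the subgraph induced on \<open>set p\<close>; a single vertex is allowed.
\<close>
definition chordless_path :: "'a list \<Rightarrow> 'a pair_pre_digraph \<Rightarrow> bool" where
  "chordless_path p G \<longleftrightarrow>
     vpath p (with_proj G) \<and>
     (\<forall>i j. i + 1 < j \<and> j < length p \<longrightarrow> (p ! i, p ! j) \<notin> parcs G)"

text \<open>
  The orientation of the list is immaterial, as the reverse of a path is a path.
  \<open>butlast (tl p)\<close> lists the interior vertices.
\<close>
definition outgoing_path ::
  "'a list \<Rightarrow> 'a pair_pre_digraph \<Rightarrow> 'a pair_pre_digraph \<Rightarrow> 'a pair_pre_digraph \<Rightarrow> bool" where
  "outgoing_path p G K\<^sub>1 K\<^sub>2 \<longleftrightarrow>
     chordless_path p G \<and> hd p \<in> pverts K\<^sub>1 \<and> last p \<in> pverts K\<^sub>2 \<and>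
     set (butlast (tl p)) \<subseteq> pverts G - (pverts K\<^sub>1 \<union> pverts K\<^sub>2)"

definition enemies ::
  "'a pair_pre_digraph \<Rightarrow> 'a pair_pre_digraph \<Rightarrow> 'a pair_pre_digraph \<Rightarrow> bool" where
  "enemies G K\<^sub>1 K\<^sub>2 \<longleftrightarrow>
     (\<forall>p. outgoing_path p G K\<^sub>1 K\<^sub>2 \<longrightarrow> odd (vwalk_length p))"

definition join_cliques ::
  "'a pair_pre_digraph \<Rightarrow> 'a pair_pre_digraph \<Rightarrow> 'a pair_pre_digraph \<Rightarrow> 'a pair_pre_digraph" where
  "join_cliques G K\<^sub>1 K\<^sub>2 =
     \<lparr>pverts = pverts G,
      parcs = parcs G \<union> pverts K\<^sub>1 \<times> pverts K\<^sub>2 \<union> pverts K\<^sub>2 \<times> pverts K\<^sub>1\<rparr>"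

end

theory Submission
  imports Defs
begin

text \<open>
  It suffices to colour the induced subgraph \<open>H\<close> of \<open>G\<close> on the vertices of an induced subgraph
  \<open>H'\<close> of the new graph with \<open>\<omega>(H')\<close> colours so that the two cliques share no colour. Start from
  any such colouring of \<open>H\<close>. If a colour \<open>i\<close> occurs in both cliques, then some colour \<open>j\<close> occurs
  in neither, since the union of the cliques is a clique of \<open>H'\<close>. The \<open>ij\<close>-component of the
  \<open>i\<close>-coloured vertex of the first clique misses the second clique: otherwise a shortest path in it
  would be an outgoing path of even length. Swapping \<open>i\<close> and \<open>j\<close> on this component reduces the
  number of shared colours.
\<close>

section \<open>Elementary descriptions of graphs, induced subgraphs and cliques\<close>

lemma pair_graph_iff:
  "pair_graph G \<longleftrightarrow> finite (pverts G) \<and> parcs G \<subseteq> pverts G \<times> pverts G \<and> sym (parcs G) \<and>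
     (\<forall>v. (v, v) \<notin> parcs G)"
proof
  assume "pair_graph G"
  then interpret pair_graph G .
  have "sym (parcs G)"
    using pair_sym_arcs by (simp add: symmetric_def)
  then show "finite (pverts G) \<and> parcs G \<subseteq> pverts G \<times> pverts G \<and> sym (parcs G) \<and>
     (\<forall>v. (v, v) \<notin> parcs G)"
    using pair_finite_verts by (auto dest: in_arcsD1 in_arcsD2 pair_no_loops)
next
  assume R: "finite (pverts G) \<and> parcs G \<subseteq> pverts G \<times> pverts G \<and> sym (parcs G) \<and>
     (\<forall>v. (v, v) \<notin> parcs G)"
  then have "finite (parcs G)"
    using finite_subset by blast
  with R show "pair_graph G"
    by unfold_locales (auto simp: symmetric_def)
qed

lemma induced_subgraph_with_proj_iff:
  assumes "pair_wf_digraph G"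
  shows "induced_subgraph (with_proj H) (with_proj G) \<longleftrightarrow>
    pverts H \<subseteq> pverts G \<and> parcs H = parcs G \<inter> pverts H \<times> pverts H"
proof
  assume "induced_subgraph (with_proj H) (with_proj G)"
  then show "pverts H \<subseteq> pverts G \<and> parcs H = parcs G \<inter> pverts H \<times> pverts H"
    by (auto simp: induced_subgraph_def subgraph_def)
next
  assume R: "pverts H \<subseteq> pverts G \<and> parcs H = parcs G \<inter> pverts H \<times> pverts H"
  then have "pair_wf_digraph H"
    by unfold_locales auto
  with R assms show "induced_subgraph (with_proj H) (with_proj G)"
    by (auto simp: induced_subgraph_def subgraph_def wf_digraph_wp_iff)
qed

lemma pair_graph_induced:
  assumes "pair_graph G" "induced_subgraph (with_proj H) (with_proj G)"
  shows "pair_graph H"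
proof -
  interpret pair_graph G by fact
  have "pverts H \<subseteq> pverts G \<and> parcs H = parcs G \<inter> pverts H \<times> pverts H"
    using assms(2) by (simp add: induced_subgraph_with_proj_iff pair_wf_digraph_axioms)
  with assms(1) show ?thesis
    unfolding pair_graph_iff sym_def by (auto intro: finite_subset)
qed

text \<open>Inducedness is automatic here: \<open>G\<close> has no loops, so its arcs inside
  \<open>pverts K\<close> join distinct vertices, and completeness of \<open>K\<close> provides all
  such pairs.\<close>

lemma clique_iff:
  assumes "pair_graph G"
  shows "clique K G \<longleftrightarrow> pverts K \<subseteq> pverts G \<and> parcs K \<subseteq> parcs G \<and>
    parcs K = {(u, v). u \<in> pverts K \<and> v \<in> pverts K \<and> u \<noteq> v}"
proof -
  interpret pair_graph G by fact
  have "finite (pverts G)" "\<forall>v. (v, v) \<notin> parcs G"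
    using assms by (auto simp: pair_graph_iff)
  then show ?thesis
    unfolding clique_def complete_digraph_pair_def
    by (auto simp: induced_subgraph_with_proj_iff pair_wf_digraph_axioms intro: finite_subset)
qed

lemma cliqueD:
  assumes "pair_graph G" "clique K G"
  shows "pverts K \<subseteq> pverts G" "u \<in> pverts K \<Longrightarrow> v \<in> pverts K \<Longrightarrow> u \<noteq> v \<Longrightarrow> (u, v) \<in> parcs G"
  using assms by (auto simp: clique_iff)

section \<open>Clique number and colourings\<close>

lemma finite_clique_cards:
  assumes "pair_graph G"
  shows "finite {card (pverts K) | K. clique K G}"
proof (rule finite_subset)
  show "{card (pverts K) | K. clique K G} \<subseteq> {..card (pverts G)}"
    using assms by (auto simp: clique_iff pair_graph_iff intro!: card_mono)
qed simp

lemma card_le_clique_number: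
  assumes "pair_graph G" "S \<subseteq> pverts G"
    and "\<And>u v. u \<in> S \<Longrightarrow> v \<in> S \<Longrightarrow> u \<noteq> v \<Longrightarrow> (u, v) \<in> parcs G"
  shows "card S \<le> clique_number G"
proof -
  have "clique \<lparr>pverts = S, parcs = {(u, v). u \<in> S \<and> v \<in> S \<and> u \<noteq> v}\<rparr> G" (is "clique ?K G")
    using assms by (auto simp: clique_iff)
  then have "card S \<in> {card (pverts K) | K. clique K G}"
    by (auto intro!: exI[of _ ?K])
  then show ?thesis
    unfolding clique_number_def by (intro Max_ge finite_clique_cards assms)
qed

lemma clique_number_attained:
  assumes "pair_graph G"
  obtains K where "clique K G" "card (pverts K) = clique_number G"
proof -
  \<comment> \<open>The empty clique keeps the set under \<open>Max\<close> nonempty, even for the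
    null graph.\<close>
  have "clique \<lparr>pverts = {}, parcs = {}\<rparr> G"
    using assms by (auto simp: clique_iff)
  then have "{card (pverts K) | K. clique K G} \<noteq> {}"
    by blast
  then have "clique_number G \<in> {card (pverts K) | K. clique K G}"
    unfolding clique_number_def by (intro Max_in finite_clique_cards assms)
  then show ?thesis
    using that by auto
qed

lemma clique_number_mono:
  assumes "pair_graph G" "pair_graph H" "pverts G \<subseteq> pverts H" "parcs G \<subseteq> parcs H"
  shows "clique_number G \<le> clique_number H"
proof -
  obtain K where K: "clique K G" "card (pverts K) = clique_number G"
    using clique_number_attained[OF assms(1)] .
  have "card (pverts K) \<le> clique_number H"
    using assms cliqueD[OF assms(1) K(1)] by (intro card_le_clique_number) auto
  with K show ?thesis by simp
qed

lemma colouring_mono: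
  assumes "colouring G k c" "k \<le> l"
  shows "colouring G l c"
  using assms by (auto simp: colouring_def)

lemma inj_on_colouring:
  assumes "colouring G k c"
    and "\<And>u v. u \<in> S \<Longrightarrow> v \<in> S \<Longrightarrow> u \<noteq> v \<Longrightarrow> (u, v) \<in> parcs G"
  shows "inj_on c S"
  using assms by (fastforce simp: colouring_def inj_on_def)

lemma clique_number_le_colouring:
  assumes "pair_graph G" "colouring G k c"
  shows "clique_number G \<le> k"
proof -
  obtain K where K: "clique K G" "card (pverts K) = clique_number G"
    using clique_number_attained[OF assms(1)] .
  have "inj_on c (pverts K)"
    using inj_on_colouring[OF assms(2)] cliqueD[OF assms(1) K(1)] by blast
  moreover have "c ` pverts K \<subseteq> {..<k}"
    using assms(2) cliqueD(1)[OF assms(1) K(1)] by (auto simp: colouring_def)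
  ultimately have "card (pverts K) \<le> card {..<k}"
    by (intro card_inj_on_le) auto
  with K show ?thesis by simp
qed

text \<open>The clique number bounds the number of colours from below, so perfection reduces to
  exhibiting colourings with that many colours.\<close>

lemma chromatic_eq_clique_number_iff:
  assumes "pair_graph G"
  shows "chromatic_number G = clique_number G \<longleftrightarrow> (\<exists>c. colouring G (clique_number G) c)"
proof
  have "finite (pverts G)"
    using assms by (simp add: pair_graph_iff)
  \<comment> \<open>Numbering the vertices injectively is a colouring, so the \<open>LEAST\<close>
    in the chromatic number is attained.\<close>
  from finite_imp_inj_to_nat_seg[OF this] obtain f and n :: nat
    where f: "f ` pverts G = {i. i < n}" "inj_on f (pverts G)"
    by (elim exE conjE)
  have "f v < n" if "v \<in> pverts G" for v
    using f(1) that by blast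
  moreover have "f u \<noteq> f v" if "(u, v) \<in> parcs G" for u v
    using inj_onD[OF f(2), of u v] that assms by (auto simp: pair_graph_iff)
  ultimately have "colouring G n f"
    by (auto simp: colouring_def)
  then have "\<exists>k c. colouring G k c"
    by blast
  then have "\<exists>c. colouring G (chromatic_number G) c"
    unfolding chromatic_number_def by (rule LeastI_ex)
  moreover assume "chromatic_number G = clique_number G"
  ultimately show "\<exists>c. colouring G (clique_number G) c" by simp
next
  assume "\<exists>c. colouring G (clique_number G) c"
  then show "chromatic_number G = clique_number G"
    unfolding chromatic_number_def
    by (rule Least_equality) (auto intro: clique_number_le_colouring assms)
qed

section \<open>Kempe chains and recolouring\<close>

lemma shortest_chain:
  assumes "(a, b) \<in> R\<^sup>*"
  obtains f :: "nat \<Rightarrow> 'a" and n where "f 0 = a" "f n = b" "\<And>i. i < n \<Longrightarrow> (f i, f (Suc i)) \<in> R"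
    "inj_on f {..n}" "\<And>i j. i + 1 < j \<Longrightarrow> j \<le> n \<Longrightarrow> (f i, f j) \<notin> R"
proof -
  define n where "n = (LEAST n. (a, b) \<in> R ^^ n)"
  have "\<exists>n. (a, b) \<in> R ^^ n"
    using assms by (simp add: rtrancl_power)
  then have "(a, b) \<in> R ^^ n"
    unfolding n_def by (rule LeastI_ex)
  have min: "n \<le> m" if "(a, b) \<in> R ^^ m" for m
    unfolding n_def using that by (rule Least_le)
  obtain f where f: "f 0 = a" "f n = b" "\<And>i. i < n \<Longrightarrow> (f i, f (Suc i)) \<in> R"
    using \<open>(a, b) \<in> R ^^ n\<close> by (auto simp: relpow_fun_conv)
  have seg: "(f i, f (i + d)) \<in> R ^^ d" if "i + d \<le> n" for i d
    unfolding relpow_fun_conv using that f(3) by (intro exI[of _ "\<lambda>m. f (i + m)"]) auto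
  \<comment> \<open>A detour of \<open>d\<close> steps from \<open>f i\<close> to \<open>f j\<close>
    cannot beat the minimum \<open>n\<close>. Below, \<open>d = 0\<close> excludes repetitions and
    \<open>d = 1\<close> excludes chords.\<close>
  have short: "n \<le> i + d + (n - j)" if "(f i, f j) \<in> R ^^ d" "i \<le> n" "j \<le> n" for i j d
  proof (rule min)
    have "(a, f i) \<in> R ^^ i" "(f j, b) \<in> R ^^ (n - j)"
      using seg[of 0 i] seg[of j "n - j"] f that by auto
    with that(1) show "(a, b) \<in> R ^^ (i + d + (n - j))"
      unfolding relpow_add by blast
  qed
  have "f i \<noteq> f j" if "i < j" "j \<le> n" for i j
    using short[of i j 0] that by auto
  then have "inj_on f {..n}"
    by (metis (no_types, lifting) atMost_iff inj_onI linorder_neqE_nat)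
  moreover have "(f i, f j) \<notin> R" if "i + 1 < j" "j \<le> n" for i j
    using short[of i j 1] that by auto
  ultimately show ?thesis
    using that f by blast
qed

text \<open>All vertices of a shortest chain in the \<open>ij\<close>-subgraph are coloured
  \<open>i\<close> or \<open>j\<close>, so a chord in \<open>G\<close> would be a chord in
  \<open>R c i j\<close>. Colours alternate along it, so two ends of colour \<open>i\<close> force
  an odd number of vertices.\<close>

lemma bicoloured_chordless_path:
  fixes G :: "'a pair_pre_digraph"
  defines "R c i j \<equiv> {(u, v) \<in> parcs G. c u \<in> {i, j} \<and> c v \<in> {i, j}}"
  assumes "colouring G k c" "(a, b) \<in> (R c i j)\<^sup>*" "a \<in> pverts G" "c a = i" "c b = i"
    and G: "pair_graph G"
  obtains p where "chordless_path p G" "hd p = a" "last p = b" "\<forall>v\<in>set p. c v \<in> {i, j}"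
    "odd (length p)"
proof -
  obtain f n where f: "f 0 = a" "f n = b" "\<And>m. m < n \<Longrightarrow> (f m, f (Suc m)) \<in> R c i j"
    "inj_on f {..n}" and chord: "\<And>l m. l + 1 < m \<Longrightarrow> m \<le> n \<Longrightarrow> (f l, f m) \<notin> R c i j"
    using shortest_chain[OF assms(3)] by blast
  have col: "c (f m) = (if even m then i else j)" if "m \<le> n" for m
    using that
  proof (induction m)
    case (Suc m)
    then have "c (f (Suc m)) \<noteq> c (f m)" "c (f (Suc m)) \<in> {i, j}"
      using f(3)[of m] \<open>colouring G k c\<close> by (auto simp: R_def colouring_def)
    with Suc show ?case by (auto split: if_splits)
  qed (simp add: f \<open>c a = i\<close>)
  define p where "p = map f [0..<Suc n]"
  have len: "length p = Suc n" and nth: "\<And>m. m \<le> n \<Longrightarrow> p ! m = f m"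
    by (simp_all add: p_def del: upt_Suc)
  \<comment> \<open>Later vertices are heads of arcs; \<open>f 0\<close> has to come from the
    assumption on \<open>a\<close>, as the chain may have no arc.\<close>
  have verts: "f m \<in> pverts G" if "m \<le> n" for m
  proof (cases m)
    case (Suc l)
    with that f(3)[of l] G show ?thesis by (auto simp: R_def pair_graph_iff)
  qed (simp add: f \<open>a \<in> pverts G\<close>)
  have cols: "\<forall>v\<in>set p. c v \<in> {i, j}"
    using col by (auto simp: p_def)
  \<comment> \<open>Generalised to suffixes because \<open>vwalk_arcs\<close> recurses from the
    front; \<open>l\<close> descends from \<open>n\<close>.\<close>
  have "set (vwalk_arcs (map f [l..<Suc n])) \<subseteq> parcs G" if "l \<le> n" for l
    using that
  proof (induction l rule: inc_induct)
    case (step l)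
    then show ?case
      using f(3)[of l] by (auto simp: upt_conv_Cons R_def simp del: upt_Suc)
  qed simp
  then have "set (vwalk_arcs p) \<subseteq> parcs G"
    by (simp add: p_def del: upt_Suc)
  moreover have "distinct p"
    using f(4) by (simp add: p_def distinct_map atLeast0LessThan lessThan_Suc_atMost del: upt_Suc)
  ultimately have "vpath p (with_proj G)"
    using verts by (auto simp: vpath_def vwalk_def p_def)
  moreover have "(p ! l, p ! m) \<notin> parcs G" if "l + 1 < m" "m < length p" for l m
  proof -
    have "c (f l) \<in> {i, j}" "c (f m) \<in> {i, j}"
      using that col[of l] col[of m] by (simp_all add: len)
    then show ?thesis
      using that chord[of l m] by (simp add: R_def nth len)
  qed
  ultimately have "chordless_path p G"
    by (simp add: chordless_path_def)
  moreover have "hd p = a" "last p = b"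
    using f by (auto simp: p_def hd_map last_map simp del: upt_Suc)
  moreover have "odd (length p)"
  proof (cases "i = j")
    case True
    \<comment> \<open>If \<open>i = j\<close>, no arc has both ends coloured \<open>i\<close>, so
      the chain is a single vertex.\<close>
    have "n = 0"
    proof (rule ccontr)
      assume "n \<noteq> 0"
      then show False
        using f(3)[of 0] True \<open>colouring G k c\<close> by (auto simp: R_def colouring_def)
    qed
    then show ?thesis by (simp add: len)
  next
    case False
    then show ?thesis
      using col[of n] f \<open>c b = i\<close> by (auto simp: len split: if_splits)
  qed
  ultimately show ?thesis
    using that cols by blast
qed

text \<open>An arc inside the component has its two colours exchanged; an arc leaving it ends in a
  colour other than \<open>i\<close> and \<open>j\<close>, which the swap neither changes nor
  produces.\<close>

lemma kempe_swap:
  fixes G :: "'a pair_pre_digraph"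
  defines "R c i j \<equiv> {(u, v) \<in> parcs G. c u \<in> {i, j} \<and> c v \<in> {i, j}}"
  assumes "colouring G k c" "sym (parcs G)" "i < k" "j < k" "c a = i"
  shows "colouring G k (\<lambda>v. if (a, v) \<in> (R c i j)\<^sup>* then if c v = i then j else i else c v)"
    (is "colouring G k ?c")
proof -
  have col: "c v \<in> {i, j}" if "(a, v) \<in> (R c i j)\<^sup>*" for v
    using that \<open>c a = i\<close> by (induction rule: rtrancl_induct) (auto simp: R_def)
  have closed: "(a, v) \<in> (R c i j)\<^sup>*"
    if "(a, u) \<in> (R c i j)\<^sup>*" "(u, v) \<in> parcs G \<or> (v, u) \<in> parcs G" "c v \<in> {i, j}" for u v
  proof -
    have "(u, v) \<in> R c i j"
      using that col[OF that(1)] \<open>sym (parcs G)\<close> by (auto simp: R_def dest: symD)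
    with that(1) show ?thesis by (rule rtrancl_into_rtrancl)
  qed
  have "?c v < k" if "v \<in> pverts G" for v
    using that \<open>colouring G k c\<close> \<open>i < k\<close> \<open>j < k\<close> by (simp add: colouring_def)
  moreover have "?c u \<noteq> ?c v" if "(u, v) \<in> parcs G" for u v
  proof -
    have "c u \<noteq> c v"
      using that \<open>colouring G k c\<close> by (auto simp: colouring_def)
    then show ?thesis
      using that col[of u] col[of v] closed[of u v] closed[of v u] by auto
  qed
  ultimately show ?thesis
    unfolding colouring_def by blast
qed

text \<open>Stated for vertex sets so that it applies to the traces of the two cliques on an induced
  subgraph. Here \<open>length p\<close> counts vertices, so \<open>even\<close> means an odd number
  of edges.\<close>

lemma enemies_disjoint_colouring:
  fixes G :: "'a pair_pre_digraph"
  assumes G: "pair_graph G" and AB: "A \<subseteq> pverts G" "B \<subseteq> pverts G"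
    and A: "\<And>u v. u \<in> A \<Longrightarrow> v \<in> A \<Longrightarrow> u \<noteq> v \<Longrightarrow> (u, v) \<in> parcs G"
    and B: "\<And>u v. u \<in> B \<Longrightarrow> v \<in> B \<Longrightarrow> u \<noteq> v \<Longrightarrow> (u, v) \<in> parcs G"
    and enemies: "\<And>p. chordless_path p G \<Longrightarrow> hd p \<in> A \<Longrightarrow> last p \<in> B \<Longrightarrow>
      set (butlast (tl p)) \<inter> (A \<union> B) = {} \<Longrightarrow> even (length p)"
    and k: "card A + card B \<le> k"
    and "colouring G k c"
  shows "\<exists>c. colouring G k c \<and> c ` A \<inter> c ` B = {}"
  using \<open>colouring G k c\<close>
proof (induction "card (c ` A \<inter> c ` B)" arbitrary: c rule: less_induct)
  case less
  have fin: "finite A" "finite B"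
    using G AB by (auto simp: pair_graph_iff intro: finite_subset)
  have inj: "inj_on c A" "inj_on c B"
    using inj_on_colouring[OF less.prems] A B by blast+
  show ?case
  proof (cases "c ` A \<inter> c ` B = {}")
    case False
    then obtain i a b where ab: "a \<in> A" "b \<in> B" "c a = i" "c b = i" by force
    \<comment> \<open>A shared colour is counted on both sides, so fewer than \<open>k\<close>
      colours occur on the two sets and a spare colour \<open>j\<close> exists.\<close>
    have "card (c ` A \<union> c ` B) + card (c ` A \<inter> c ` B) = card (c ` A) + card (c ` B)"
      using card_Un_Int[of "c ` A" "c ` B"] fin by simp
    moreover have "card (c ` A \<inter> c ` B) > 0"
      using False fin by (simp add: card_gt_0_iff)
    ultimately have "card (c ` A \<union> c ` B) < card {..<k}"
      using k fin card_image_le[of A c] card_image_le[of B c] by simp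
    then have "\<not> {..<k} \<subseteq> c ` A \<union> c ` B"
      using fin card_mono[of "c ` A \<union> c ` B" "{..<k}"] by auto
    then obtain j where j: "j < k" "j \<notin> c ` A" "j \<notin> c ` B" by auto
    have "i < k"
      using less.prems ab AB by (auto simp: colouring_def)
    define C where
      "C = {v. (a, v) \<in> {(u, v) \<in> parcs G. c u \<in> {i, j} \<and> c v \<in> {i, j}}\<^sup>*}"
    \<comment> \<open>Colours within each set are distinct and \<open>j\<close> occurs in neither,
      so \<open>a\<close> and \<open>b\<close> are the only candidates. Hence a bicoloured path has
      its interior outside both sets.\<close>
    have only_a: "v = a" if "v \<in> A" "c v \<in> {i, j}" for v
      using that j ab inj by (auto simp: inj_on_def)
    have only_b: "v = b" if "v \<in> B" "c v \<in> {i, j}" for v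
      using that j ab inj by (auto simp: inj_on_def)
    have "b \<notin> C"
    proof
      assume "b \<in> C"
      then obtain p where p: "chordless_path p G" "hd p = a" "last p = b"
        "\<forall>v\<in>set p. c v \<in> {i, j}" "odd (length p)"
        using bicoloured_chordless_path[OF less.prems _ _ ab(3,4) G, of j] ab AB
        unfolding C_def by blast
      have "p \<noteq> []" "distinct p"
        using p(1) by (auto simp: chordless_path_def vpath_def vwalk_def)
      then obtain q where "p = a # q"
        using p(2) by (cases p) auto
      have interior: "set (butlast q) \<subseteq> set p - {a, b}"
      proof (cases q rule: rev_cases)
        case (snoc r x)
        then show ?thesis
          using \<open>p = a # q\<close> \<open>distinct p\<close> p(3) by auto
      qed simp
      have "set (butlast (tl p)) \<inter> (A \<union> B) = {}"
        using \<open>p = a # q\<close> interior p(4) only_a only_b by fastforce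
      then show False
        using enemies[OF p(1)] p ab by simp
    qed
    have C_col: "c v \<in> {i, j}" if "v \<in> C" for v
      using that unfolding C_def mem_Collect_eq
      by (induction rule: rtrancl_induct) (use ab in auto)
    define c' where "c' = (\<lambda>v. if v \<in> C then if c v = i then j else i else c v)"
    have c': "colouring G k c'"
      using kempe_swap[OF less.prems _ \<open>i < k\<close> j(1) ab(3)] G
      by (simp add: c'_def C_def pair_graph_iff)
    have "a \<in> C"
      by (simp add: C_def)
    then have "c' a = j"
      using ab by (simp add: c'_def)
    have c'_A: "c' v = c v" if "v \<in> A" "v \<noteq> a" for v
      using that only_a C_col by (auto simp: c'_def)
    have c'_B: "c' v = c v" if "v \<in> B" for v
      using that only_b C_col \<open>b \<notin> C\<close> by (auto simp: c'_def)
    \<comment> \<open>The swap leaves \<open>B\<close> untouched and on \<open>A\<close> trades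
      \<open>i\<close> for \<open>j\<close>, a colour absent from \<open>B\<close>; thus
      \<open>i\<close> stops being shared and no new shared colour appears.\<close>
    have "c' ` B = c ` B"
      using c'_B by simp
    moreover have "c' ` A \<subseteq> insert j (c ` A - {i})"
    proof
      fix x assume "x \<in> c' ` A"
      then obtain v where v: "v \<in> A" "x = c' v" by blast
      show "x \<in> insert j (c ` A - {i})"
      proof (cases "v = a")
        case False
        then have "c v \<noteq> i"
          using only_a v(1) by blast
        then show ?thesis
          using c'_A[OF v(1) False] v by simp
      qed (use v \<open>c' a = j\<close> in simp)
    qed
    ultimately have "c' ` A \<inter> c' ` B \<subseteq> c ` A \<inter> c ` B - {i}"
      using j by auto
    moreover have "i \<in> c ` A \<inter> c ` B"
      using ab by (metis IntI imageI)
    ultimately have "c' ` A \<inter> c' ` B \<subset> c ` A \<inter> c ` B"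
      by blast
    then have "card (c' ` A \<inter> c' ` B) < card (c ` A \<inter> c ` B)"
      using fin by (intro psubset_card_mono) auto
    then show ?thesis
      using less.hyps c' by blast
  qed (use less.prems in blast)
qed

section \<open>Transfer to the joined graph\<close>

lemma enemies_disjoint:
  assumes "pair_graph G" "clique K\<^sub>1 G" "enemies G K\<^sub>1 K\<^sub>2"
  shows "pverts K\<^sub>1 \<inter> pverts K\<^sub>2 = {}"
proof (rule ccontr)
  assume "pverts K\<^sub>1 \<inter> pverts K\<^sub>2 \<noteq> {}"
  then obtain v where v: "v \<in> pverts K\<^sub>1" "v \<in> pverts K\<^sub>2" by blast
  \<comment> \<open>A one-vertex path has an empty interior and the even length 0.\<close>
  then have "outgoing_path [v] G K\<^sub>1 K\<^sub>2"
    using cliqueD(1)[OF assms(1,2)]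
    by (auto simp: outgoing_path_def chordless_path_def vpath_def vwalk_def)
  then show False
    using assms(3) by (force simp: enemies_def)
qed

text \<open>A chord in \<open>G\<close> would join two vertices of \<open>H\<close> and hence be an
  arc of the induced subgraph \<open>H\<close>.\<close>

lemma chordless_path_induced:
  assumes "pair_wf_digraph G" "induced_subgraph (with_proj H) (with_proj G)" "chordless_path p H"
  shows "chordless_path p G" "set p \<subseteq> pverts H"
proof -
  have H: "pverts H \<subseteq> pverts G" "parcs H = parcs G \<inter> pverts H \<times> pverts H"
    using assms(2) by (simp_all add: induced_subgraph_with_proj_iff[OF assms(1)])
  show p: "set p \<subseteq> pverts H"
    using assms(3) by (simp add: chordless_path_def vpath_def vwalk_def)
  then have "(p ! i, p ! j) \<in> pverts H \<times> pverts H" if "i < length p" "j < length p" for i j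
    using that nth_mem by blast
  then show "chordless_path p G"
    using assms(3) H p unfolding chordless_path_def vpath_def vwalk_def by fastforce
qed

theorem mainTheorem9:
  fixes G K\<^sub>1 K\<^sub>2 :: "'a pair_pre_digraph"
  assumes "perfect_graph G"
    and "clique K\<^sub>1 G" and "clique K\<^sub>2 G"
    and "enemies G K\<^sub>1 K\<^sub>2"
  shows "perfect_graph (join_cliques G K\<^sub>1 K\<^sub>2)"
proof -
  let ?J = "join_cliques G K\<^sub>1 K\<^sub>2"
  have G: "pair_graph G"
    using assms(1) by (simp add: perfect_graph_def)
  then interpret pair_graph G .
  note K1 = cliqueD[OF G assms(2)] and K2 = cliqueD[OF G assms(3)]
  have disj: "pverts K\<^sub>1 \<inter> pverts K\<^sub>2 = {}"
    using enemies_disjoint[OF G assms(2,4)] .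
  \<comment> \<open>Disjointness of the cliques ensures that joining them creates no loop.\<close>
  have J: "pair_graph ?J"
    using G K1(1) K2(1) disj
    by (auto simp: pair_graph_iff join_cliques_def sym_def)
  then interpret J: pair_graph ?J .
  have "chromatic_number H' = clique_number H'"
    if H': "induced_subgraph (with_proj H') (with_proj ?J)" for H' :: "'a pair_pre_digraph"
  proof -
    have pgH': "pair_graph H'"
      using pair_graph_induced[OF J H'] .
    have vH': "pverts H' \<subseteq> pverts G"
      and aH': "parcs H' = parcs ?J \<inter> pverts H' \<times> pverts H'"
      using H' unfolding induced_subgraph_with_proj_iff[OF J.pair_wf_digraph_axioms]
      by (simp_all add: join_cliques_def)
    \<comment> \<open>\<open>H'\<close> arises from \<open>H\<close> by joining the traces
      \<open>?A\<close> and \<open>?B\<close> of the two cliques.\<close>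
    define H where "H = \<lparr>pverts = pverts H', parcs = parcs G \<inter> pverts H' \<times> pverts H'\<rparr>"
    have H: "induced_subgraph (with_proj H) (with_proj G)"
      using vH' by (simp add: induced_subgraph_with_proj_iff[OF pair_wf_digraph_axioms] H_def)
    have pgH: "pair_graph H"
      using pair_graph_induced[OF G H] .
    obtain c where "colouring H (clique_number H) c"
      using assms(1) H chromatic_eq_clique_number_iff[OF pgH] by (auto simp: perfect_graph_def)
    moreover have "clique_number H \<le> clique_number H'"
      by (rule clique_number_mono[OF pgH pgH']) (auto simp: aH' H_def join_cliques_def)
    ultimately have c: "colouring H (clique_number H') c"
      by (rule colouring_mono)
    let ?A = "pverts K\<^sub>1 \<inter> pverts H'" and ?B = "pverts K\<^sub>2 \<inter> pverts H'"
    have "finite ?A" "finite ?B"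
      using pgH' by (auto simp: pair_graph_iff)
    \<comment> \<open>In \<open>H'\<close> the union of the traces is complete, which gives the
      bound required for a spare colour.\<close>
    then have "card ?A + card ?B = card (?A \<union> ?B)"
      using disj by (intro card_Un_disjoint[symmetric]) auto
    also have "\<dots> \<le> clique_number H'"
      using K1(2) K2(2) by (intro card_le_clique_number[OF pgH']) (auto simp: aH' join_cliques_def)
    finally have card: "card ?A + card ?B \<le> clique_number H'" .
    have even: "even (length p)"
      if p: "chordless_path p H" "hd p \<in> ?A" "last p \<in> ?B"
        and int: "set (butlast (tl p)) \<inter> (?A \<union> ?B) = {}" for p
    proof -
      have pG: "chordless_path p G" "set p \<subseteq> pverts H'"
        using chordless_path_induced[OF pair_wf_digraph_axioms H p(1)] by (auto simp: H_def)
      have "set (butlast (tl p)) \<subseteq> set p"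
        by (cases p) (auto dest: in_set_butlastD)
      \<comment> \<open>The interior lies in \<open>pverts H'\<close>, so avoiding the traces means
        avoiding the whole cliques.\<close>
      then have "outgoing_path p G K\<^sub>1 K\<^sub>2"
        using pG p int vH' by (auto simp: outgoing_path_def)
      then have "odd (length p - 1)"
        using assms(4) by (auto simp: enemies_def)
      then show ?thesis by (cases "length p") auto
    qed
    have "\<exists>d. colouring H (clique_number H') d \<and> d ` ?A \<inter> d ` ?B = {}"
      by (rule enemies_disjoint_colouring[OF pgH _ _ _ _ even card c])
        (use K1(2) K2(2) in \<open>simp_all add: H_def\<close>)
    then obtain d where d: "colouring H (clique_number H') d" "d ` ?A \<inter> d ` ?B = {}"
      by blast
    \<comment> \<open>Every arc of \<open>H'\<close> that is not in \<open>H\<close> runs between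
      \<open>?A\<close> and \<open>?B\<close>.\<close>
    have "d u \<noteq> d v" if "u \<in> ?A" "v \<in> ?B" for u v
      using d(2) that by blast
    then have "colouring H' (clique_number H') d"
      using d(1) unfolding colouring_def aH' by (fastforce simp: H_def join_cliques_def)
    then show ?thesis
      using chromatic_eq_clique_number_iff[OF pgH'] by blast
  qed
  with J show ?thesis
    by (simp add: perfect_graph_def)
qed

end
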